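(* Let $(X,\mathcal{A},\nu)$ be a measure space, $1\le p<\infty$, and let $f_1,\dots,f_n$ be real-valued functions in $L^p(\nu)$. Let $\mu=(\mu_1,\dots,\mu_m)$ and $\lambda=(\lambda_1,\dots,\lambda_n)$ be probability vectors, and let $\omega_1,\omega_2$ be two weight functions with respect to $\mu$ and $\lambda$. Then $$\left\|\sum_{j=1}^n\lambda_jf_j\right\|_p^p\le\sum_{i=1}^m\mu_i\left\|L_p^p\left(\sum_{j=1}^n\omega_1(i,j)\lambda_j|f_j|,\ \sum_{j=1}^n\omega_2(i,j)\lambda_j|f_j|\right)\right\|_1\le\sum_{j=1}^n\lambda_j\|f_j\|_p^p.$$ In particular, if $B=[b_{ij}]_{n\times n}$ and $C=[c_{ij}]_{n\times n}$ are two double stochastic matrices, then $$\left\|\frac{f_1+\cdots+f_n}{n}\right\|_p^p\le\frac1n\sum_{i=1}^n\left\|L_p^p\left(\sum_{j=1}^nb_{ij}|f_j|,\ \sum_{j=1}^nc_{ij}|f_j|\right)\right\|_1\le\frac{\|f_1\|_p^p+\cdots+\|f_n\|_p^p}{n},$$ and $$\left\|\frac{f_1+\cdots+f_n}{n}\right\|_p^p\le\frac1n\sum_{i=1}^n\left\|L_p^p\left(|f_i|,\ |f_{n+1-i}|\right)\right\|_1\le\frac{\|f_1\|_p^p+\cdots+\|f_n\|_p^p}{n}.$$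
   Context: $m,n\ge1$ are integers. Probability vectors: $\mu_i\ge0$, $\lambda_j\ge0$, $\sum_{i=1}^m\mu_i=1$, $\sum_{j=1}^n\lambda_j=1$. A weight function with respect to $\mu$ and $\lambda$ is a map $\omega:\{1,\dots,m\}\times\{1,\dots,n\}\to[0,\infty)$ such that $\sum_{i=1}^m\omega(i,j)\mu_i=1$ for every $j=1,\dots,n$ and $\sum_{j=1}^n\omega(i,j)\lambda_j=1$ for every $i=1,\dots,m$. A double stochastic matrix is a square matrix with nonnegative real entries each of whose rows and columns sums to $1$. The $p$-logarithmic mean of $a,b\ge0$ is $L_p(a,b)=a$ if $a=b$, and $L_p(a,b)=\left[\frac{b^{p+1}-a^{p+1}}{(p+1)(b-a)}\right]^{1/p}$ if $a\ne b$; $L_p^p(a,b)$ denotes $(L_p(a,b))^p$. For nonnegative functions $g,h$ on $X$, $L_p^p(g,h)$ is the function $x\mapsto L_p^p(g(x),h(x))$. $\|\cdot\|_p$ and $\|\cdot\|_1$ are the norms of $L^p(\nu)$ and $L^1(\nu)$. *)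

theory Defs
  imports "HOL-Analysis.Analysis"
begin

text \<open>
  Vectors of length \<open>n\<close> and \<open>m \<times> n\<close> matrices are functions on \<open>nat\<close> whose values matter only at
  the indices \<open>{1..n}\<close>, respectively \<open>{1..m}\<close> and \<open>{1..n}\<close>.
\<close>

definition prob_vector :: "nat \<Rightarrow> (nat \<Rightarrow> real) \<Rightarrow> bool" where
  "prob_vector n v \<longleftrightarrow> (\<forall>i\<in>{1..n}. 0 \<le> v i) \<and> (\<Sum>i=1..n. v i) = 1"

definition weight_function ::
  "nat \<Rightarrow> nat \<Rightarrow> (nat \<Rightarrow> real) \<Rightarrow> (nat \<Rightarrow> real) \<Rightarrow> (nat \<Rightarrow> nat \<Rightarrow> real) \<Rightarrow> bool" where
  "weight_function m n \<mu> lam \<omega> \<longleftrightarrow>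
     (\<forall>i\<in>{1..m}. \<forall>j\<in>{1..n}. 0 \<le> \<omega> i j) \<and>
     (\<forall>j\<in>{1..n}. (\<Sum>i=1..m. \<omega> i j * \<mu> i) = 1) \<and>
     (\<forall>i\<in>{1..m}. (\<Sum>j=1..n. \<omega> i j * lam j) = 1)"

definition double_stochastic :: "nat \<Rightarrow> (nat \<Rightarrow> nat \<Rightarrow> real) \<Rightarrow> bool" where
  "double_stochastic n B \<longleftrightarrow>
     (\<forall>i\<in>{1..n}. \<forall>j\<in>{1..n}. 0 \<le> B i j) \<and>
     (\<forall>i\<in>{1..n}. (\<Sum>j=1..n. B i j) = 1) \<and>
     (\<forall>j\<in>{1..n}. (\<Sum>i=1..n. B i j) = 1)"

text \<open>Intended for \<open>a, b \<ge> 0\<close> and \<open>p \<ge> 1\<close>; there \<open>powr\<close> is the usual power, also at base 0.\<close>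

definition log_mean :: "real \<Rightarrow> real \<Rightarrow> real \<Rightarrow> real" where
  "log_mean p a b =
     (if a = b then a
      else ((b powr (p + 1) - a powr (p + 1)) / ((p + 1) * (b - a))) powr (1 / p))"

text \<open>
  Functions are not identified when they agree almost everywhere.  The norm is real-valued and
  is meaningful only on \<open>Lp_space M p\<close>: the Bochner integral of a non-integrable function is 0.
\<close>

definition Lp_space :: "'a measure \<Rightarrow> real \<Rightarrow> ('a \<Rightarrow> real) set" where
  "Lp_space M p = {f \<in> borel_measurable M. integrable M (\<lambda>x. \<bar>f x\<bar> powr p)}"

definition Lp_norm :: "'a measure \<Rightarrow> real \<Rightarrow> ('a \<Rightarrow> real) \<Rightarrow> real" where
  "Lp_norm M p f = (LINT x|M. \<bar>f x\<bar> powr p) powr (1 / p)"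

end

theory Submission
  imports Defs
begin

text \<open>
  For \<open>a, b \<ge> 0\<close> with \<open>a \<noteq> b\<close>, the number \<open>log_mean p a b powr p\<close> is the average of the convex
  function \<open>t \<mapsto> t powr p\<close> over the segment between \<open>a\<close> and \<open>b\<close>.  The Hermite-Hadamard inequality
  therefore places it between \<open>((a + b) / 2) powr p\<close> and \<open>(a powr p + b powr p) / 2\<close>
  (\<open>log_mean_powr_lower\<close>, \<open>log_mean_powr_upper\<close>).

  The weights enter only through the products \<open>\<omega> i j * lam j\<close>.  These form a row-stochastic matrix
  that sends the distribution \<open>\<mu>\<close> to the distribution \<open>lam\<close>, so averaging with its rows and then
  averaging over \<open>\<mu>\<close> is the same as averaging with \<open>lam\<close>.  Write \<open>A i\<close> and \<open>B i\<close> for the two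
  row averages of nonnegative numbers \<open>y j\<close>.  The \<open>\<mu>\<close>-mean of \<open>(A i + B i) / 2\<close> is the \<open>lam\<close>-mean
  of \<open>y\<close>, so Jensen's inequality over \<open>\<mu>\<close> together with the lower Hermite-Hadamard bound gives
  the left inequality (\<open>mean_powr_le_sum_log_mean\<close>).  Jensen's inequality over each row bounds
  \<open>A i powr p\<close> and \<open>B i powr p\<close> by row averages of \<open>y j powr p\<close>, and the upper Hermite-Hadamard
  bound then gives the right one (\<open>sum_log_mean_le_mean_powr\<close>).

  Putting \<open>y j = \<bar>f j x\<bar>\<close> and integrating over \<open>x\<close> gives the statement for norms
  (\<open>norm_inequalities\<close>); the row bound also supplies the integrable majorant that makes the
  middle term finite.  A double stochastic matrix sends the uniform distribution to itself, and the
  last inequality is the case of the identity and the order-reversing permutation matrix.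
\<close>

section \<open>The Hermite-Hadamard inequality\<close>

text \<open>The graph of \<open>g\<close> lies below its chord, and the chord has mean value \<open>(g a + g b) / 2\<close>.\<close>

lemma hermite_hadamard_upper:
  fixes g :: "real \<Rightarrow> real"
  assumes "a < b" and conv: "convex_on {a..b} g" and int: "(g has_integral I) {a..b}"
  shows "I \<le> (b - a) * ((g a + g b) / 2)"
proof -
  define s where "s = (g b - g a) / (b - a)"
  define P where "P x = s * (x - a)\<^sup>2 / 2 + g a * x" for x
  have "((\<lambda>x. s * (x - a) + g a) has_integral (P b - P a)) {a..b}"
    using \<open>a < b\<close> unfolding P_def
    by (intro fundamental_theorem_of_calculus)
       (auto intro!: derivative_eq_intros
             simp flip: has_real_derivative_iff_has_vector_derivative)
  moreover have "g x \<le> s * (x - a) + g a" if "x \<in> {a..b}" for x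
    unfolding s_def using convex_onD_Icc'[OF conv that] .
  ultimately have "I \<le> P b - P a"
    using has_integral_le[OF int] by blast
  also have "P b - P a = (s * (b - a)) * (b - a) / 2 + g a * (b - a)"
    by (simp add: P_def power2_eq_square algebra_simps)
  also have "s * (b - a) = g b - g a"
    using \<open>a < b\<close> by (simp add: s_def)
  finally show ?thesis
    by (simp add: field_simps)
qed

text \<open>
  Reflection in the midpoint preserves the integral, and by convexity the sum of the values of \<open>g\<close>
  at two mirror points is at least twice the value at the midpoint.
\<close>

lemma hermite_hadamard_lower:
  fixes g :: "real \<Rightarrow> real"
  assumes "a < b" and conv: "convex_on {a..b} g" and int: "(g has_integral I) {a..b}"
  shows "(b - a) * g ((a + b) / 2) \<le> I"
proof -
  have "((\<lambda>x. g (a + b - x)) has_integral I) {a..b}"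
    using has_integral_affinity[of g I a b "-1" "a + b"] int \<open>a < b\<close>
    by (simp add: algebra_simps image_diff_atLeastAtMost[of "a + b"] flip: image_image)
  then have "((\<lambda>x. g x + g (a + b - x)) has_integral I + I) {a..b}"
    by (intro has_integral_add int)
  moreover have "((\<lambda>x. 2 * g ((a + b) / 2)) has_integral (b - a) * (2 * g ((a + b) / 2))) {a..b}"
    using has_integral_const_real[of "2 * g ((a + b) / 2)" a b] \<open>a < b\<close> by simp
  moreover have "2 * g ((a + b) / 2) \<le> g x + g (a + b - x)" if "x \<in> {a..b}" for x
    using convex_onD[OF conv, of "1/2" x "a + b - x"] that
    by (simp add: field_simps)
  ultimately have "(b - a) * (2 * g ((a + b) / 2)) \<le> I + I"
    by (meson has_integral_le)
  then show ?thesis by simp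
qed

section \<open>Powers of the logarithmic mean\<close>

text \<open>
  The second derivative gives convexity only on the open half-line, since \<open>powr\<close> need not be
  differentiable at 0.  On a segment that starts at 0 the convexity inequality reads
  \<open>(t * y) powr p \<le> t * y powr p\<close>, which follows from \<open>t powr p \<le> t\<close>.
\<close>

lemma convex_on_powr_nonneg:
  fixes p :: real
  assumes "1 \<le> p"
  shows "convex_on {0..} (\<lambda>x. x powr p)"
proof (rule convex_on_linorderI)
  fix t x y :: real
  assume t: "0 < t" "t < 1" and xy: "x \<in> {0..}" "y \<in> {0..}" "x < y"
  show "((1 - t) *\<^sub>R x + t *\<^sub>R y) powr p \<le> (1 - t) * x powr p + t * y powr p"
  proof (cases "x = 0")
    case True
    have "t powr p \<le> t powr 1"
      using t assms by (intro powr_mono') auto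
    then show ?thesis
      using True t xy by (simp add: powr_mult mult_right_mono)
  next
    case False
    then show ?thesis
      using convex_onD[OF powr_convex[OF assms], of t x y] t xy by simp
  qed
qed (simp add: convex_real_interval)

lemma powr_sum_le_sum_powr:
  fixes p :: real and y :: "'i \<Rightarrow> real"
  assumes "1 \<le> p" "finite S" "\<And>i. i \<in> S \<Longrightarrow> 0 \<le> w i" "sum w S = 1" "\<And>i. i \<in> S \<Longrightarrow> 0 \<le> y i"
  shows "(\<Sum>i\<in>S. w i * y i) powr p \<le> (\<Sum>i\<in>S. w i * y i powr p)"
proof -
  have "S \<noteq> {}" using \<open>sum w S = 1\<close> by auto
  then show ?thesis
    using convex_on_sum[OF \<open>finite S\<close> _ convex_on_powr_nonneg[OF \<open>1 \<le> p\<close>], of w y] assms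
    by simp
qed

lemma log_mean_commute: "log_mean p a b = log_mean p b a"
proof -
  have "(b powr (p + 1) - a powr (p + 1)) / ((p + 1) * (b - a))
      = (a powr (p + 1) - b powr (p + 1)) / ((p + 1) * (a - b))"
    by (metis minus_diff_eq minus_divide_divide mult_minus_right)
  then show ?thesis
    by (simp add: log_mean_def)
qed

text \<open>
  The outer power cancels the root in the logarithmic mean, and the remaining difference quotient
  is built from the antiderivative \<open>t powr (p + 1) / (p + 1)\<close>.  At \<open>a = 0\<close> the antiderivative is
  used only through its continuity at the left endpoint.
\<close>

lemma log_mean_powr_has_integral:
  assumes p: "1 \<le> p" and ab: "0 \<le> a" "a < b"
  shows "((\<lambda>t. t powr p) has_integral (b - a) * log_mean p a b powr p) {a..b}"
proof -
  have "a powr (p + 1) \<le> b powr (p + 1)"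
    using p ab by (intro powr_mono2) auto
  then have "log_mean p a b powr p = (b powr (p + 1) - a powr (p + 1)) / ((p + 1) * (b - a))"
    using p ab by (simp add: log_mean_def powr_powr)
  then have *: "(b - a) * log_mean p a b powr p = b powr (p + 1) / (p + 1) - a powr (p + 1) / (p + 1)"
    using p ab by (simp add: divide_simps mult_ac)
  show ?thesis
    unfolding *
  proof (rule fundamental_theorem_of_calculus_interior)
    show "continuous_on {a..b} (\<lambda>t. t powr (p + 1) / (p + 1))"
      using p ab by (intro continuous_on_divide continuous_on_powr' continuous_intros) auto
    show "((\<lambda>t. t powr (p + 1) / (p + 1)) has_vector_derivative t powr p) (at t)"
      if "t \<in> {a<..<b}" for t
      using that p ab unfolding has_real_derivative_iff_has_vector_derivative[symmetric]
      by (auto intro!: derivative_eq_intros)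
  qed (use ab in simp)
qed

lemma log_mean_powr_lower:
  assumes "1 \<le> p" "0 \<le> a" "0 \<le> b"
  shows "((a + b) / 2) powr p \<le> log_mean p a b powr p"
  using assms(2,3)
proof (induction a b rule: linorder_wlog)
  case (le a b)
  show ?case
  proof (cases "a = b")
    case False
    then have "a < b" using le by simp
    have "convex_on {a..b} (\<lambda>t. t powr p)"
      using convex_on_subset[OF convex_on_powr_nonneg[OF assms(1)]] le by auto
    then show ?thesis
      using hermite_hadamard_lower[OF \<open>a < b\<close> _ log_mean_powr_has_integral] assms(1) le \<open>a < b\<close> by simp
  qed (simp add: log_mean_def)
qed (simp add: log_mean_commute add.commute)

lemma log_mean_powr_upper:
  assumes "1 \<le> p" "0 \<le> a" "0 \<le> b"
  shows "log_mean p a b powr p \<le> (a powr p + b powr p) / 2"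
  using assms(2,3)
proof (induction a b rule: linorder_wlog)
  case (le a b)
  show ?case
  proof (cases "a = b")
    case False
    then have "a < b" using le by simp
    have "convex_on {a..b} (\<lambda>t. t powr p)"
      using convex_on_subset[OF convex_on_powr_nonneg[OF assms(1)]] le by auto
    then have "(b - a) * log_mean p a b powr p \<le> (b - a) * ((a powr p + b powr p) / 2)"
      using hermite_hadamard_upper[OF \<open>a < b\<close> _ log_mean_powr_has_integral] assms(1) le \<open>a < b\<close> by simp
    then show ?thesis
      using \<open>a < b\<close> by (simp only: mult_le_cancel_left_pos diff_gt_0_iff_gt)
  qed (simp add: log_mean_def)
qed (simp add: log_mean_commute add.commute)

lemma borel_measurable_log_mean [measurable]:
  assumes [measurable]: "g \<in> borel_measurable M" "h \<in> borel_measurable M"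
  shows "(\<lambda>x. log_mean p (g x) (h x)) \<in> borel_measurable M"
  unfolding log_mean_def by measurable

section \<open>Pointwise inequalities for stochastic matrices\<close>

text \<open>
  A Markov kernel from \<open>{1..m}\<close> to \<open>{1..n}\<close> that sends the distribution \<open>\<mu>\<close> to \<open>lam\<close>.  A weight
  function is the density of such a kernel with respect to \<open>lam\<close>; the kernel itself also covers
  double stochastic matrices without a factor \<open>n\<close>.
\<close>

definition stochastic_transport ::
  "nat \<Rightarrow> nat \<Rightarrow> (nat \<Rightarrow> real) \<Rightarrow> (nat \<Rightarrow> real) \<Rightarrow> (nat \<Rightarrow> nat \<Rightarrow> real) \<Rightarrow> bool" where
  "stochastic_transport m n \<mu> lam K \<longleftrightarrow>
     (\<forall>i\<in>{1..m}. \<forall>j\<in>{1..n}. 0 \<le> K i j) \<and>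
     (\<forall>i\<in>{1..m}. (\<Sum>j=1..n. K i j) = 1) \<and>
     (\<forall>j\<in>{1..n}. (\<Sum>i=1..m. \<mu> i * K i j) = lam j)"

lemma weight_function_imp_transport:
  assumes "prob_vector n lam" "weight_function m n \<mu> lam \<omega>"
  shows "stochastic_transport m n \<mu> lam (\<lambda>i j. \<omega> i j * lam j)"
proof -
  have "(\<Sum>i=1..m. \<mu> i * (\<omega> i j * lam j)) = (\<Sum>i=1..m. \<omega> i j * \<mu> i) * lam j" for j
    unfolding sum_distrib_right by (simp add: mult_ac)
  then show ?thesis
    using assms by (simp add: stochastic_transport_def weight_function_def prob_vector_def)
qed

lemma double_stochastic_imp_transport:
  assumes "double_stochastic n B"
  shows "stochastic_transport n n (\<lambda>_. 1 / real n) (\<lambda>_. 1 / real n) B"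
  using assms
  by (simp add: stochastic_transport_def double_stochastic_def flip: sum_divide_distrib)

lemma transport_mean:
  assumes "stochastic_transport m n \<mu> lam K"
  shows "(\<Sum>i=1..m. \<mu> i * (\<Sum>j=1..n. K i j * y j)) = (\<Sum>j=1..n. lam j * y j)"
proof -
  have "(\<Sum>i=1..m. \<mu> i * (\<Sum>j=1..n. K i j * y j)) = (\<Sum>j=1..n. \<Sum>i=1..m. \<mu> i * K i j * y j)"
    by (subst sum.swap) (simp add: sum_distrib_left mult.assoc)
  also have "\<dots> = (\<Sum>j=1..n. lam j * y j)"
    using assms by (intro sum.cong) (simp_all add: stochastic_transport_def flip: sum_distrib_right)
  finally show ?thesis .
qed

lemma transport_row_nonneg:
  assumes "stochastic_transport m n \<mu> lam K" "i \<in> {1..m}" "\<And>j. j \<in> {1..n} \<Longrightarrow> 0 \<le> y j"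
  shows "0 \<le> (\<Sum>j=1..n. K i j * y j)"
  using assms by (intro sum_nonneg) (simp add: stochastic_transport_def)

lemma mean_powr_le_sum_log_mean:
  assumes p: "1 \<le> p" and \<mu>: "prob_vector m \<mu>"
    and K: "stochastic_transport m n \<mu> lam K" and L: "stochastic_transport m n \<mu> lam L"
    and y: "\<And>j. j \<in> {1..n} \<Longrightarrow> 0 \<le> y j"
  shows "(\<Sum>j=1..n. lam j * y j) powr p
       \<le> (\<Sum>i=1..m. \<mu> i * log_mean p (\<Sum>j=1..n. K i j * y j) (\<Sum>j=1..n. L i j * y j) powr p)"
proof -
  define A where "A i = (\<Sum>j=1..n. K i j * y j)" for i
  define B where "B i = (\<Sum>j=1..n. L i j * y j)" for i
  have nonneg: "0 \<le> A i" "0 \<le> B i" if "i \<in> {1..m}" for i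
    unfolding A_def B_def using transport_row_nonneg[OF K that, of y] transport_row_nonneg[OF L that, of y] y
    by blast+
  have "(\<Sum>i=1..m. \<mu> i * ((A i + B i) / 2))
      = ((\<Sum>i=1..m. \<mu> i * A i) + (\<Sum>i=1..m. \<mu> i * B i)) / 2"
    by (simp add: sum.distrib distrib_left add_divide_distrib flip: sum_divide_distrib)
  also have "\<dots> = (\<Sum>j=1..n. lam j * y j)"
    unfolding A_def B_def transport_mean[OF K] transport_mean[OF L] by simp
  finally have "(\<Sum>j=1..n. lam j * y j) powr p = (\<Sum>i=1..m. \<mu> i * ((A i + B i) / 2)) powr p"
    by simp
  also have "\<dots> \<le> (\<Sum>i=1..m. \<mu> i * ((A i + B i) / 2) powr p)"
    using p \<mu> nonneg by (intro powr_sum_le_sum_powr) (auto simp: prob_vector_def)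
  also have "\<dots> \<le> (\<Sum>i=1..m. \<mu> i * log_mean p (A i) (B i) powr p)"
    using p \<mu> nonneg
    by (intro sum_mono mult_left_mono log_mean_powr_lower) (auto simp: prob_vector_def)
  finally show ?thesis
    by (simp add: A_def B_def)
qed

text \<open>
  This bound holds row by row, before averaging over \<open>\<mu>\<close>, so it also serves as the integrable
  majorant for a single index \<open>i\<close>, including one with \<open>\<mu> i = 0\<close>.
\<close>

lemma log_mean_rows_le:
  assumes p: "1 \<le> p" and i: "i \<in> {1..m}"
    and K: "stochastic_transport m n \<mu> lam K" and L: "stochastic_transport m n \<mu> lam L"
    and y: "\<And>j. j \<in> {1..n} \<Longrightarrow> 0 \<le> y j"
  shows "log_mean p (\<Sum>j=1..n. K i j * y j) (\<Sum>j=1..n. L i j * y j) powr p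
       \<le> ((\<Sum>j=1..n. K i j * y j powr p) + (\<Sum>j=1..n. L i j * y j powr p)) / 2"
proof -
  have "(\<Sum>j=1..n. K i j * y j) powr p \<le> (\<Sum>j=1..n. K i j * y j powr p)"
    using p i K y by (intro powr_sum_le_sum_powr) (auto simp: stochastic_transport_def)
  moreover have "(\<Sum>j=1..n. L i j * y j) powr p \<le> (\<Sum>j=1..n. L i j * y j powr p)"
    using p i L y by (intro powr_sum_le_sum_powr) (auto simp: stochastic_transport_def)
  moreover have "0 \<le> (\<Sum>j=1..n. K i j * y j)" "0 \<le> (\<Sum>j=1..n. L i j * y j)"
    using transport_row_nonneg[OF K i, of y] transport_row_nonneg[OF L i, of y] y by blast+
  ultimately show ?thesis
    using log_mean_powr_upper[OF p, of "\<Sum>j=1..n. K i j * y j" "\<Sum>j=1..n. L i j * y j"]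
    by simp
qed

lemma sum_log_mean_le_mean_powr:
  assumes p: "1 \<le> p" and \<mu>: "prob_vector m \<mu>"
    and K: "stochastic_transport m n \<mu> lam K" and L: "stochastic_transport m n \<mu> lam L"
    and y: "\<And>j. j \<in> {1..n} \<Longrightarrow> 0 \<le> y j"
  shows "(\<Sum>i=1..m. \<mu> i * log_mean p (\<Sum>j=1..n. K i j * y j) (\<Sum>j=1..n. L i j * y j) powr p)
       \<le> (\<Sum>j=1..n. lam j * y j powr p)"
proof -
  let ?A = "\<lambda>i. \<Sum>j=1..n. K i j * y j powr p" and ?B = "\<lambda>i. \<Sum>j=1..n. L i j * y j powr p"
  have "(\<Sum>i=1..m. \<mu> i * log_mean p (\<Sum>j=1..n. K i j * y j) (\<Sum>j=1..n. L i j * y j) powr p)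
      \<le> (\<Sum>i=1..m. \<mu> i * ((?A i + ?B i) / 2))"
    using \<mu> by (intro sum_mono mult_left_mono log_mean_rows_le[OF p _ K L y])
      (auto simp: prob_vector_def)
  also have "\<dots> = ((\<Sum>i=1..m. \<mu> i * ?A i) + (\<Sum>i=1..m. \<mu> i * ?B i)) / 2"
    by (simp add: sum.distrib distrib_left add_divide_distrib flip: sum_divide_distrib)
  also have "\<dots> = (\<Sum>j=1..n. lam j * y j powr p)"
    unfolding transport_mean[OF K] transport_mean[OF L] by simp
  finally show ?thesis .
qed

section \<open>Integration\<close>

lemma Lp_norm_powr:
  assumes "1 \<le> p"
  shows "Lp_norm M p g powr p = (LINT x|M. \<bar>g x\<bar> powr p)"
proof -
  have "0 \<le> (LINT x|M. \<bar>g x\<bar> powr p)"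
    by (intro integral_nonneg_AE) simp
  then show ?thesis
    using assms by (simp add: Lp_norm_def powr_powr)
qed

lemma Lp_norm_1_nonneg:
  assumes "\<And>x. 0 \<le> g x"
  shows "Lp_norm M 1 g = (LINT x|M. g x)"
proof -
  have "0 \<le> (LINT x|M. g x)"
    using assms by simp
  then show ?thesis
    using assms by (simp add: Lp_norm_def)
qed

lemma Lp_space_1_nonneg_iff:
  assumes "\<And>x. 0 \<le> g x"
  shows "g \<in> Lp_space M 1 \<longleftrightarrow> integrable M g"
  using assms by (auto simp: Lp_space_def)

theorem norm_inequalities:
  assumes p: "1 \<le> p" and \<mu>: "prob_vector m \<mu>" and lam: "prob_vector n lam"
    and f: "\<forall>j\<in>{1..n}. f j \<in> Lp_space M p"
    and K: "stochastic_transport m n \<mu> lam K" and L: "stochastic_transport m n \<mu> lam L"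
  defines "\<Phi> \<equiv> \<lambda>i x. log_mean p (\<Sum>j=1..n. K i j * \<bar>f j x\<bar>) (\<Sum>j=1..n. L i j * \<bar>f j x\<bar>) powr p"
  shows "\<forall>i\<in>{1..m}. \<Phi> i \<in> Lp_space M 1"
    and "Lp_norm M p (\<lambda>x. \<Sum>j=1..n. lam j * f j x) powr p \<le> (\<Sum>i=1..m. \<mu> i * Lp_norm M 1 (\<Phi> i))"
    and "(\<Sum>i=1..m. \<mu> i * Lp_norm M 1 (\<Phi> i)) \<le> (\<Sum>j=1..n. lam j * Lp_norm M p (f j) powr p)"
proof -
  have meas [measurable]: "f j \<in> borel_measurable M" if "j \<in> {1..n}" for j
    using f that by (simp add: Lp_space_def)
  have int: "integrable M (\<lambda>x. \<bar>f j x\<bar> powr p)" if "j \<in> {1..n}" for j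
    using f that by (simp add: Lp_space_def)
  have \<Phi>_nonneg: "0 \<le> \<Phi> i x" for i x
    by (simp add: \<Phi>_def)
  have \<Phi>_int: "integrable M (\<Phi> i)" if "i \<in> {1..m}" for i
  proof (rule Bochner_Integration.integrable_bound)
    show "integrable M (\<lambda>x. ((\<Sum>j=1..n. K i j * \<bar>f j x\<bar> powr p)
        + (\<Sum>j=1..n. L i j * \<bar>f j x\<bar> powr p)) / 2)"
      by (intro integrable_divide Bochner_Integration.integrable_add
          Bochner_Integration.integrable_sum integrable_mult_right int)
    show "\<Phi> i \<in> borel_measurable M"
      unfolding \<Phi>_def by measurable
    have "\<Phi> i x \<le> ((\<Sum>j=1..n. K i j * \<bar>f j x\<bar> powr p) + (\<Sum>j=1..n. L i j * \<bar>f j x\<bar> powr p)) / 2" for x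
      unfolding \<Phi>_def by (rule log_mean_rows_le[OF p that K L]) simp
    then show "AE x in M. norm (\<Phi> i x)
        \<le> norm (((\<Sum>j=1..n. K i j * \<bar>f j x\<bar> powr p) + (\<Sum>j=1..n. L i j * \<bar>f j x\<bar> powr p)) / 2)"
      using \<Phi>_nonneg by (intro AE_I2) (smt (verit) real_norm_def)
  qed
  then show "\<forall>i\<in>{1..m}. \<Phi> i \<in> Lp_space M 1"
    using \<Phi>_nonneg by (simp add: Lp_space_1_nonneg_iff)
  have sum_int: "integrable M (\<lambda>x. \<Sum>i=1..m. \<mu> i * \<Phi> i x)"
    by (intro Bochner_Integration.integrable_sum integrable_mult_right \<Phi>_int)
  have middle: "(\<Sum>i=1..m. \<mu> i * Lp_norm M 1 (\<Phi> i)) = (LINT x|M. (\<Sum>i=1..m. \<mu> i * \<Phi> i x))"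
    using \<Phi>_int by (subst Bochner_Integration.integral_sum)
      (auto simp: Lp_norm_1_nonneg \<Phi>_nonneg)
  have "\<bar>\<Sum>j=1..n. lam j * f j x\<bar> powr p \<le> (\<Sum>i=1..m. \<mu> i * \<Phi> i x)" for x
  proof -
    have "\<bar>\<Sum>j=1..n. lam j * f j x\<bar> \<le> (\<Sum>j=1..n. lam j * \<bar>f j x\<bar>)"
      using lam by (intro order_trans[OF sum_abs] sum_mono) (simp add: abs_mult prob_vector_def)
    then have "\<bar>\<Sum>j=1..n. lam j * f j x\<bar> powr p \<le> (\<Sum>j=1..n. lam j * \<bar>f j x\<bar>) powr p"
      using p by (intro powr_mono2) auto
    also have "\<dots> \<le> (\<Sum>i=1..m. \<mu> i * \<Phi> i x)"
      unfolding \<Phi>_def by (rule mean_powr_le_sum_log_mean[OF p \<mu> K L]) simp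
    finally show ?thesis .
  qed
  then show "Lp_norm M p (\<lambda>x. \<Sum>j=1..n. lam j * f j x) powr p \<le> (\<Sum>i=1..m. \<mu> i * Lp_norm M 1 (\<Phi> i))"
    unfolding middle Lp_norm_powr[OF p]
    using \<mu> by (intro Bochner_Integration.integral_mono' sum_int)
      (auto intro!: sum_nonneg simp: prob_vector_def \<Phi>_nonneg)
  have "(LINT x|M. (\<Sum>i=1..m. \<mu> i * \<Phi> i x)) \<le> (LINT x|M. (\<Sum>j=1..n. lam j * \<bar>f j x\<bar> powr p))"
  proof (rule Bochner_Integration.integral_mono[OF sum_int])
    show "integrable M (\<lambda>x. \<Sum>j=1..n. lam j * \<bar>f j x\<bar> powr p)"
      by (intro Bochner_Integration.integrable_sum integrable_mult_right int)
    show "(\<Sum>i=1..m. \<mu> i * \<Phi> i x) \<le> (\<Sum>j=1..n. lam j * \<bar>f j x\<bar> powr p)" for x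
      unfolding \<Phi>_def by (rule sum_log_mean_le_mean_powr[OF p \<mu> K L]) simp
  qed
  also have "\<dots> = (\<Sum>j=1..n. lam j * Lp_norm M p (f j) powr p)"
    using int by (subst Bochner_Integration.integral_sum) (auto simp: Lp_norm_powr[OF p])
  finally show "(\<Sum>i=1..m. \<mu> i * Lp_norm M 1 (\<Phi> i)) \<le> (\<Sum>j=1..n. lam j * Lp_norm M p (f j) powr p)"
    unfolding middle .
qed

corollary norm_inequalities_double_stochastic:
  assumes p: "1 \<le> p" and n: "1 \<le> n"
    and f: "\<forall>j\<in>{1..n}. f j \<in> Lp_space M p"
    and B: "double_stochastic n B" and C: "double_stochastic n C"
  defines "\<Phi> \<equiv> \<lambda>i x. log_mean p (\<Sum>j=1..n. B i j * \<bar>f j x\<bar>) (\<Sum>j=1..n. C i j * \<bar>f j x\<bar>) powr p"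
  shows "\<forall>i\<in>{1..n}. \<Phi> i \<in> Lp_space M 1"
    and "Lp_norm M p (\<lambda>x. (\<Sum>j=1..n. f j x) / real n) powr p
       \<le> 1 / real n * (\<Sum>i=1..n. Lp_norm M 1 (\<Phi> i))"
    and "1 / real n * (\<Sum>i=1..n. Lp_norm M 1 (\<Phi> i))
       \<le> (\<Sum>j=1..n. Lp_norm M p (f j) powr p) / real n"
proof -
  have unif: "prob_vector n (\<lambda>_. 1 / real n)"
    using n by (simp add: prob_vector_def)
  note * = norm_inequalities[OF p unif unif f
      double_stochastic_imp_transport[OF B] double_stochastic_imp_transport[OF C]]
  show "\<forall>i\<in>{1..n}. \<Phi> i \<in> Lp_space M 1"
    unfolding \<Phi>_def by (rule *(1))
  show "Lp_norm M p (\<lambda>x. (\<Sum>j=1..n. f j x) / real n) powr p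
      \<le> 1 / real n * (\<Sum>i=1..n. Lp_norm M 1 (\<Phi> i))"
    using *(2) unfolding \<Phi>_def by (simp flip: sum_divide_distrib)
  show "1 / real n * (\<Sum>i=1..n. Lp_norm M 1 (\<Phi> i)) \<le> (\<Sum>j=1..n. Lp_norm M p (f j) powr p) / real n"
    using *(3) unfolding \<Phi>_def by (simp flip: sum_divide_distrib)
qed

lemma double_stochastic_permutation:
  assumes "bij_betw \<sigma> {1..n} {1..n}"
  shows "double_stochastic n (\<lambda>i j. if j = \<sigma> i then 1 else 0)"
proof -
  have "\<sigma> i \<in> {1..n}" if "i \<in> {1..n}" for i
    using assms that by (auto simp: bij_betw_def)
  moreover have "(\<Sum>i=1..n. if j = \<sigma> i then 1 else 0 :: real) = 1" if "j \<in> {1..n}" for j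
    using sum.reindex_bij_betw[OF assms, of "\<lambda>k. if j = k then 1 else 0 :: real"] that by simp
  ultimately show ?thesis
    by (auto simp: double_stochastic_def)
qed

theorem theorem3p3:
  fixes M :: "'a measure" and p :: real and n :: nat and f :: "nat \<Rightarrow> 'a \<Rightarrow> real"
  assumes p: "1 \<le> p"
    and n: "1 \<le> n"
    and f: "\<forall>j\<in>{1..n}. f j \<in> Lp_space M p"
  shows
    "(\<forall>(m::nat) \<mu> lam \<omega>1 \<omega>2.
        1 \<le> m \<longrightarrow> prob_vector m \<mu> \<longrightarrow> prob_vector n lam \<longrightarrow>
        weight_function m n \<mu> lam \<omega>1 \<longrightarrow> weight_function m n \<mu> lam \<omega>2 \<longrightarrow>
        (\<forall>i\<in>{1..m}.
           (\<lambda>x. log_mean p (\<Sum>j=1..n. \<omega>1 i j * lam j * \<bar>f j x\<bar>)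
                           (\<Sum>j=1..n. \<omega>2 i j * lam j * \<bar>f j x\<bar>) powr p) \<in> Lp_space M 1) \<and>
        Lp_norm M p (\<lambda>x. \<Sum>j=1..n. lam j * f j x) powr p
          \<le> (\<Sum>i=1..m. \<mu> i * Lp_norm M 1
               (\<lambda>x. log_mean p (\<Sum>j=1..n. \<omega>1 i j * lam j * \<bar>f j x\<bar>)
                               (\<Sum>j=1..n. \<omega>2 i j * lam j * \<bar>f j x\<bar>) powr p)) \<and>
        (\<Sum>i=1..m. \<mu> i * Lp_norm M 1
               (\<lambda>x. log_mean p (\<Sum>j=1..n. \<omega>1 i j * lam j * \<bar>f j x\<bar>)
                               (\<Sum>j=1..n. \<omega>2 i j * lam j * \<bar>f j x\<bar>) powr p))
          \<le> (\<Sum>j=1..n. lam j * Lp_norm M p (f j) powr p))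
     \<and>
     (\<forall>B C. double_stochastic n B \<longrightarrow> double_stochastic n C \<longrightarrow>
        (\<forall>i\<in>{1..n}.
           (\<lambda>x. log_mean p (\<Sum>j=1..n. B i j * \<bar>f j x\<bar>)
                           (\<Sum>j=1..n. C i j * \<bar>f j x\<bar>) powr p) \<in> Lp_space M 1) \<and>
        Lp_norm M p (\<lambda>x. (\<Sum>j=1..n. f j x) / real n) powr p
          \<le> 1 / real n * (\<Sum>i=1..n. Lp_norm M 1
               (\<lambda>x. log_mean p (\<Sum>j=1..n. B i j * \<bar>f j x\<bar>)
                               (\<Sum>j=1..n. C i j * \<bar>f j x\<bar>) powr p)) \<and>
        1 / real n * (\<Sum>i=1..n. Lp_norm M 1
               (\<lambda>x. log_mean p (\<Sum>j=1..n. B i j * \<bar>f j x\<bar>)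
                               (\<Sum>j=1..n. C i j * \<bar>f j x\<bar>) powr p))
          \<le> (\<Sum>j=1..n. Lp_norm M p (f j) powr p) / real n)
     \<and>
     ((\<forall>i\<in>{1..n}. (\<lambda>x. log_mean p \<bar>f i x\<bar> \<bar>f (n + 1 - i) x\<bar> powr p) \<in> Lp_space M 1) \<and>
      Lp_norm M p (\<lambda>x. (\<Sum>j=1..n. f j x) / real n) powr p
        \<le> 1 / real n * (\<Sum>i=1..n. Lp_norm M 1
             (\<lambda>x. log_mean p \<bar>f i x\<bar> \<bar>f (n + 1 - i) x\<bar> powr p)) \<and>
      1 / real n * (\<Sum>i=1..n. Lp_norm M 1
             (\<lambda>x. log_mean p \<bar>f i x\<bar> \<bar>f (n + 1 - i) x\<bar> powr p))
        \<le> (\<Sum>j=1..n. Lp_norm M p (f j) powr p) / real n)"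
proof (intro conjI allI impI)
  fix m :: nat and \<mu> lam :: "nat \<Rightarrow> real" and \<omega>1 \<omega>2 :: "nat \<Rightarrow> nat \<Rightarrow> real"
  assume \<mu>: "prob_vector m \<mu>" and lam: "prob_vector n lam"
    and \<omega>: "weight_function m n \<mu> lam \<omega>1" "weight_function m n \<mu> lam \<omega>2"
  note * = norm_inequalities[OF p \<mu> lam f
      weight_function_imp_transport[OF lam \<omega>(1)] weight_function_imp_transport[OF lam \<omega>(2)]]
  show "\<forall>i\<in>{1..m}.
      (\<lambda>x. log_mean p (\<Sum>j=1..n. \<omega>1 i j * lam j * \<bar>f j x\<bar>)
                      (\<Sum>j=1..n. \<omega>2 i j * lam j * \<bar>f j x\<bar>) powr p) \<in> Lp_space M 1"
    by (rule *(1))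
  show "Lp_norm M p (\<lambda>x. \<Sum>j=1..n. lam j * f j x) powr p
      \<le> (\<Sum>i=1..m. \<mu> i * Lp_norm M 1
           (\<lambda>x. log_mean p (\<Sum>j=1..n. \<omega>1 i j * lam j * \<bar>f j x\<bar>)
                           (\<Sum>j=1..n. \<omega>2 i j * lam j * \<bar>f j x\<bar>) powr p))"
    by (rule *(2))
  show "(\<Sum>i=1..m. \<mu> i * Lp_norm M 1
           (\<lambda>x. log_mean p (\<Sum>j=1..n. \<omega>1 i j * lam j * \<bar>f j x\<bar>)
                           (\<Sum>j=1..n. \<omega>2 i j * lam j * \<bar>f j x\<bar>) powr p))
      \<le> (\<Sum>j=1..n. lam j * Lp_norm M p (f j) powr p)"
    by (rule *(3))
next
  fix B C :: "nat \<Rightarrow> nat \<Rightarrow> real"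
  assume BC: "double_stochastic n B" "double_stochastic n C"
  note * = norm_inequalities_double_stochastic[OF p n f BC]
  show "\<forall>i\<in>{1..n}.
      (\<lambda>x. log_mean p (\<Sum>j=1..n. B i j * \<bar>f j x\<bar>) (\<Sum>j=1..n. C i j * \<bar>f j x\<bar>) powr p)
        \<in> Lp_space M 1"
    by (rule *(1))
  show "Lp_norm M p (\<lambda>x. (\<Sum>j=1..n. f j x) / real n) powr p
      \<le> 1 / real n * (\<Sum>i=1..n. Lp_norm M 1
           (\<lambda>x. log_mean p (\<Sum>j=1..n. B i j * \<bar>f j x\<bar>) (\<Sum>j=1..n. C i j * \<bar>f j x\<bar>) powr p))"
    by (rule *(2))
  show "1 / real n * (\<Sum>i=1..n. Lp_norm M 1
           (\<lambda>x. log_mean p (\<Sum>j=1..n. B i j * \<bar>f j x\<bar>) (\<Sum>j=1..n. C i j * \<bar>f j x\<bar>) powr p))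
      \<le> (\<Sum>j=1..n. Lp_norm M p (f j) powr p) / real n"
    by (rule *(3))
next
  define P where "P \<sigma> i j = (if j = \<sigma> i then 1 else 0 :: real)" for \<sigma> :: "nat \<Rightarrow> nat" and i j
  have row: "(\<Sum>j=1..n. P \<sigma> i j * \<bar>f j x\<bar>) = \<bar>f (\<sigma> i) x\<bar>" if "\<sigma> i \<in> {1..n}" for \<sigma> i x
    using that by (simp add: P_def if_distrib[of "\<lambda>c. c * _"] cong: if_cong)
  have I: "double_stochastic n (P (\<lambda>i. i))"
    unfolding P_def by (intro double_stochastic_permutation bij_betwI[where g = "\<lambda>i. i"]) auto
  have R: "double_stochastic n (P (\<lambda>i. n + 1 - i))"
    unfolding P_def
    by (intro double_stochastic_permutation bij_betwI[where g = "\<lambda>i. n + 1 - i"]) auto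
  note * = norm_inequalities_double_stochastic[OF p n f I R]
  have \<Phi>: "(\<lambda>x. log_mean p (\<Sum>j=1..n. P (\<lambda>i. i) i j * \<bar>f j x\<bar>)
                      (\<Sum>j=1..n. P (\<lambda>i. n + 1 - i) i j * \<bar>f j x\<bar>) powr p)
      = (\<lambda>x. log_mean p \<bar>f i x\<bar> \<bar>f (n + 1 - i) x\<bar> powr p)" if "i \<in> {1..n}" for i
  proof -
    have "i \<in> {1..n}" "n + 1 - i \<in> {1..n}" using that by auto
    then show ?thesis by (simp only: row)
  qed
  have sum_\<Phi>: "(\<Sum>i=1..n. Lp_norm M 1
        (\<lambda>x. log_mean p (\<Sum>j=1..n. P (\<lambda>i. i) i j * \<bar>f j x\<bar>)
                        (\<Sum>j=1..n. P (\<lambda>i. n + 1 - i) i j * \<bar>f j x\<bar>) powr p))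
      = (\<Sum>i=1..n. Lp_norm M 1 (\<lambda>x. log_mean p \<bar>f i x\<bar> \<bar>f (n + 1 - i) x\<bar> powr p))"
    by (intro sum.cong refl) (simp only: \<Phi>)
  show "\<forall>i\<in>{1..n}. (\<lambda>x. log_mean p \<bar>f i x\<bar> \<bar>f (n + 1 - i) x\<bar> powr p) \<in> Lp_space M 1"
  proof
    fix i assume i: "i \<in> {1..n}"
    show "(\<lambda>x. log_mean p \<bar>f i x\<bar> \<bar>f (n + 1 - i) x\<bar> powr p) \<in> Lp_space M 1"
      using bspec[OF *(1) i] unfolding \<Phi>[OF i] .
  qed
  show "Lp_norm M p (\<lambda>x. (\<Sum>j=1..n. f j x) / real n) powr p
      \<le> 1 / real n * (\<Sum>i=1..n. Lp_norm M 1
           (\<lambda>x. log_mean p \<bar>f i x\<bar> \<bar>f (n + 1 - i) x\<bar> powr p))"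
    using *(2) unfolding sum_\<Phi> .
  show "1 / real n * (\<Sum>i=1..n. Lp_norm M 1
           (\<lambda>x. log_mean p \<bar>f i x\<bar> \<bar>f (n + 1 - i) x\<bar> powr p))
      \<le> (\<Sum>j=1..n. Lp_norm M p (f j) powr p) / real n"
    using *(3) unfolding sum_\<Phi> .
qed

end
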